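(* Let $\varphi\in\mathfrak{M}_+(\mathbb{R}_+)$ and let $\varphi^\natural$ be its tamping. Then for every $\nu>0$ and every $x\in\mathbb{R}_+$, $$\mathrm{meas}\big([0,x]\cap\{\varphi\geq\nu\}\big)\;\leq\;\mathrm{meas}\big([0,x]\cap\{\varphi^\natural\geq\nu\}\big).$$
   Context: $\mathbb{R}_+=[0,+\infty)$, $\mathrm{meas}$ is Lebesgue measure, $\mathfrak{M}_+(\mathbb{R}_+)$ is the set of non-negative measurable functions on $\mathbb{R}_+$ (identified when equal a.e.), and $\{\varphi\ge\nu\}=\{x\in\mathbb{R}_+:\varphi(x)\ge\nu\}$. Hollows. For $A\subseteq\mathbb{R}_+$ measurable, the essential convex hull is $\mathrm{conv\,ess}\,A:=\bigcap_{\mathrm{meas}(A\triangle B)=0}\mathrm{conv}\,B$. The hollows of $A$ are $\mathcal{H}(A):=(\mathrm{conv\,ess}\,A)\setminus A$ (understood up to null sets). For $\varphi\in\mathfrak{M}_+(\mathbb{R}_+)$ and $\nu\in(0,+\infty]$, $\mathcal{H}_\nu(\varphi):=\bigcup_{\lambda<\nu}\mathcal{H}(\{\varphi\ge\lambda\})$. Tamping. For $\nu>0$ let $x_\nu(\varphi):=\mathrm{inf\,ess}\{\varphi\ge\nu\}$, where $\mathrm{inf\,ess}\,A:=\sup\{a\ge0:\mathrm{meas}(A\cap[0,a])=0\}$, and, when $\mathrm{meas}\{\varphi\ge\nu\}>0$, $y_\nu(\varphi):=x_\nu(\varphi)-\mathrm{meas}(\mathcal{H}_\infty(\varphi)\cap[0,x_\nu(\varphi)])$.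 Put $S_\nu(\varphi):=[\,y_\nu(\varphi),\,y_\nu(\varphi)+\mathrm{meas}\{\varphi\ge\nu\}\,]$ (meaning $[y_\nu(\varphi),+\infty)$ if $\mathrm{meas}\{\varphi\ge\nu\}=+\infty$, and $\emptyset$ if $\mathrm{meas}\{\varphi\ge\nu\}=0$). These sets are non-increasing in $\nu$. The tamping $\varphi^\natural:\mathbb{R}_+\to[0,+\infty]$ of $\varphi$ is the function whose superlevel sets $\{\varphi^\natural\ge\nu\}$ are the $S_\nu(\varphi)$; explicitly $\varphi^\natural(x):=\sup\{\nu>0: x\in S_\nu(\varphi)\}$ with $\sup\emptyset=0$ (for almost every $\nu$, $\{\varphi^\natural\ge\nu\}=S_\nu(\varphi)$ up to a null set). *)

theory Defs
  imports "HOL-Analysis.Analysis"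
begin

text \<open>
  Functions on the half-line are represented by total functions \<open>real \<Rightarrow> ennreal\<close>, of which only the
  values on \<open>{0..}\<close> matter. Sets and functions are representatives of their classes modulo null
  sets. Null sets are expressed by membership in \<^term>\<open>null_sets lebesgue\<close>, because
  \<^const>\<open>emeasure\<close> is also \<open>0\<close> on non-measurable sets.
\<close>

definition superlevel :: "(real \<Rightarrow> ennreal) \<Rightarrow> ennreal \<Rightarrow> real set" where
  "superlevel \<phi> \<nu> = {x. 0 \<le> x \<and> \<nu> \<le> \<phi> x}"

definition conv_ess :: "real set \<Rightarrow> real set" where
  "conv_ess A = \<Inter> {convex hull B | B. B \<subseteq> {0..} \<and> sym_diff A B \<in> null_sets lebesgue}"

definition hollows :: "real set \<Rightarrow> real set" where
  "hollows A = conv_ess A - A"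

definition hollows_below :: "ennreal \<Rightarrow> (real \<Rightarrow> ennreal) \<Rightarrow> real set" where
  "hollows_below \<nu> \<phi> = (\<Union>\<mu>\<in>{..<\<nu>}. hollows (superlevel \<phi> \<mu>))"

text \<open>The value is \<open>\<infinity>\<close> exactly when \<open>A \<inter> {0..}\<close> is null.\<close>

definition inf_ess :: "real set \<Rightarrow> ennreal" where
  "inf_ess A = Sup {ennreal a | a. 0 \<le> a \<and> A \<inter> {0..a} \<in> null_sets lebesgue}"

definition tamp_x :: "(real \<Rightarrow> ennreal) \<Rightarrow> real \<Rightarrow> ennreal" where
  "tamp_x \<phi> \<nu> = inf_ess (superlevel \<phi> (ennreal \<nu>))"

text \<open>
  Only meaningful when the superlevel set has positive measure; then \<^const>\<open>tamp_x\<close> is finite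
  and the conversion \<^const>\<open>enn2real\<close> loses nothing.
\<close>

definition tamp_y :: "(real \<Rightarrow> ennreal) \<Rightarrow> real \<Rightarrow> real" where
  "tamp_y \<phi> \<nu> =
    (let x = enn2real (tamp_x \<phi> \<nu>) in x - measure lebesgue (hollows_below \<infinity> \<phi> \<inter> {0..x}))"

definition tamp_set :: "(real \<Rightarrow> ennreal) \<Rightarrow> real \<Rightarrow> real set" where
  "tamp_set \<phi> \<nu> =
    (let m = emeasure lebesgue (superlevel \<phi> (ennreal \<nu>)); y = tamp_y \<phi> \<nu> in
     if m = 0 then {} else if m = \<infinity> then {y..} else {y..y + enn2real m})"

text \<open>Here \<open>Sup {} = 0\<close> in \<^typ>\<open>ennreal\<close>.\<close>

definition tamping :: "(real \<Rightarrow> ennreal) \<Rightarrow> real \<Rightarrow> ennreal" where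
  "tamping \<phi> x = Sup {ennreal \<nu> | \<nu>. 0 < \<nu> \<and> x \<in> tamp_set \<phi> \<nu>}"

end

theory Submission
  imports Defs
begin

text \<open>
  Write \<open>H\<close> for the union of all hollows and \<open>r \<nu>\<close> for the essential infimum of
  \<open>{\<phi> \<ge> \<nu>}\<close>, so that \<open>y \<nu> = meas ([0, r \<nu>] - H)\<close>. For \<open>\<mu> < \<nu>\<close>, the part of \<open>(r \<mu>, r \<nu>]\<close> outside
  \<open>H\<close> lies in \<open>{\<phi> \<ge> \<mu>}\<close>, which makes the intervals \<open>S \<nu>\<close> decrease in \<open>\<nu>\<close>. The superlevel
  sets of the tamping are therefore intervals, in particular measurable, and \<open>{\<phi>\<^sup>\<natural> \<ge> \<nu>}\<close> contains
  \<open>S \<nu>\<close>. As \<open>{\<phi> \<ge> \<nu>}\<close> has the same measure as \<open>S \<nu>\<close> and essentially starts at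
  \<open>r \<nu> \<ge> y \<nu>\<close>, it occupies at most as much of \<open>[0, x]\<close>.
\<close>

section \<open>Essential convex hulls\<close>

text \<open>If \<open>A\<close> is null on one side of \<open>x\<close>, deleting that side gives a
  representative whose hull misses \<open>x\<close>. Otherwise every representative \<open>B\<close>
  has points on both sides of \<open>x\<close>, so its hull contains \<open>x\<close>.\<close>

lemma conv_ess_eq:
  assumes "A \<subseteq> {0..}"
  shows "conv_ess A = {x. A \<inter> {0..x} \<notin> null_sets lebesgue \<and> A \<inter> {x..} \<notin> null_sets lebesgue}"
proof (intro set_eqI iffI)
  fix x assume x: "x \<in> conv_ess A"
  have hull: "x \<in> convex hull B" if "B \<subseteq> {0..}" "sym_diff A B \<in> null_sets lebesgue" for B
    using x that unfolding conv_ess_def by blast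
  have "A \<inter> {0..x} \<notin> null_sets lebesgue"
  proof
    assume null: "A \<inter> {0..x} \<in> null_sets lebesgue"
    have "x \<in> convex hull (A \<inter> {x<..})"
      using assms by (intro hull null_sets_completion_subset[OF _ null]) auto
    moreover have "convex hull (A \<inter> {x<..}) \<subseteq> {x<..}"
      by (rule hull_minimal) auto
    ultimately show False by auto
  qed
  moreover have "A \<inter> {x..} \<notin> null_sets lebesgue"
  proof
    assume null: "A \<inter> {x..} \<in> null_sets lebesgue"
    have "x \<in> convex hull (A \<inter> {..<x})"
      using assms by (intro hull null_sets_completion_subset[OF _ null]) auto
    moreover have "convex hull (A \<inter> {..<x}) \<subseteq> {..<x}"
      by (rule hull_minimal) auto
    ultimately show False by auto
  qed
  ultimately show "x \<in> {x. A \<inter> {0..x} \<notin> null_sets lebesgue \<and> A \<inter> {x..} \<notin> null_sets lebesgue}"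
    by simp
next
  fix x assume x: "x \<in> {x. A \<inter> {0..x} \<notin> null_sets lebesgue \<and> A \<inter> {x..} \<notin> null_sets lebesgue}"
  show "x \<in> conv_ess A"
    unfolding conv_ess_def
  proof clarify
    fix B :: "real set"
    assume B: "B \<subseteq> {0..}" "sym_diff A B \<in> null_sets lebesgue"
    have meets: "B \<inter> I \<noteq> {}" if "A \<inter> I \<notin> null_sets lebesgue" for I
    proof
      assume "B \<inter> I = {}"
      then have "A \<inter> I \<subseteq> sym_diff A B" by auto
      with B that show False using null_sets_completion_subset by blast
    qed
    obtain u v where "u \<in> B" "u \<le> x" "v \<in> B" "x \<le> v"
      using meets[of "{0..x}"] meets[of "{x..}"] x by auto
    then show "x \<in> convex hull B"
      by (meson convex_convex_hull hull_inc is_interval_convex_1 mem_is_interval_1_I)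
  qed
qed

lemma conv_ess_mono:
  assumes "A \<subseteq> B" and "B \<subseteq> {0..}"
  shows "conv_ess A \<subseteq> conv_ess B"
proof -
  have "A \<inter> I \<in> null_sets lebesgue" if "B \<inter> I \<in> null_sets lebesgue" for I
    using assms by (intro null_sets_completion_subset[OF _ that]) auto
  moreover have "A \<subseteq> {0..}" using assms by auto
  ultimately show ?thesis
    using assms(2) by (auto simp: conv_ess_eq)
qed

lemma sets_conv_ess: "conv_ess A \<in> sets lebesgue"
proof -
  have "convex (conv_ess A)"
    unfolding conv_ess_def by (intro convex_Inter) auto
  then show ?thesis
    using real_interval_borel_measurable is_interval_convex_1 by auto
qed

section \<open>The essential infimum of a non-null set\<close>

text \<open>The set \<open>N\<close> of all \<open>a\<close> for which \<open>[0, a]\<close> meets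
  \<open>A\<close> in a null set is closed downwards. It is bounded because \<open>A\<close> is not
  null, and it contains its supremum by a countable union, so it equals
  \<open>[0, r]\<close>.\<close>

lemma inf_ess_finite:
  assumes sub: "A \<subseteq> {0..}" and pos: "A \<notin> null_sets lebesgue"
  obtains r where "0 \<le> r" "inf_ess A = ennreal r"
    "\<And>a. 0 \<le> a \<Longrightarrow> A \<inter> {0..a} \<in> null_sets lebesgue \<longleftrightarrow> a \<le> r"
proof -
  define N where "N = {a. 0 \<le> a \<and> A \<inter> {0..a} \<in> null_sets lebesgue}"
  have zero: "0 \<in> N"
    unfolding N_def by (auto intro: null_sets_completion_subset[of _ "{0}"])
  have down: "b \<in> N" if "a \<in> N" "0 \<le> b" "b \<le> a" for a b
  proof -
    have "A \<inter> {0..b} \<subseteq> A \<inter> {0..a}" using that by auto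
    then show ?thesis
      using that null_sets_completion_subset unfolding N_def by blast
  qed
  have "\<exists>n. real n \<notin> N"
  proof (rule ccontr)
    assume "\<nexists>n. real n \<notin> N"
    then have "(\<Union>n. A \<inter> {0..real n}) \<in> null_sets lebesgue"
      by (intro null_sets_UN) (auto simp: N_def)
    moreover have "A \<subseteq> (\<Union>n. A \<inter> {0..real n})"
      using sub real_arch_simple by fastforce
    ultimately show False
      using pos null_sets_completion_subset by blast
  qed
  then obtain n where "real n \<notin> N" by blast
  then have bdd: "bdd_above N"
    using down by (intro bdd_aboveI[of _ "real n"]) (metis le_cases of_nat_0_le_iff)
  define r where "r = Sup N"
  have r0: "0 \<le> r"
    unfolding r_def using cSup_upper[OF zero bdd] .
  \<comment> \<open>These intervals exhaust \<open>[0, r)\<close>; the endpoint \<open>r\<close> is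
    added below as a null singleton. When the upper bound is negative the interval is empty.\<close>
  have "A \<inter> {0..r - 1 / Suc n} \<in> null_sets lebesgue" for n
  proof (cases "0 \<le> r - 1 / Suc n")
    case True
    have "r - 1 / Suc n < Sup N" unfolding r_def by simp
    then obtain a where "a \<in> N" "r - 1 / Suc n < a"
      using zero bdd less_cSup_iff by (metis empty_iff)
    then show ?thesis
      using down[of a "r - 1 / Suc n"] True by (auto simp: N_def)
  qed simp
  then have "insert r (\<Union>n. A \<inter> {0..r - 1 / Suc n}) \<in> null_sets lebesgue"
    by (subst insert_is_Un) (intro null_sets.Un null_sets_UN, auto)
  moreover have "A \<inter> {0..r} \<subseteq> insert r (\<Union>n. A \<inter> {0..r - 1 / Suc n})"
  proof
    fix t assume t: "t \<in> A \<inter> {0..r}"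
    show "t \<in> insert r (\<Union>n. A \<inter> {0..r - 1 / Suc n})"
    proof (cases "t = r")
      case False
      with t have "0 < r - t" by simp
      then obtain n where "1 / Suc n < r - t"
        using nat_approx_posE by blast
      then have "t \<le> r - 1 / Suc n" by linarith
      with t show ?thesis by auto
    qed simp
  qed
  ultimately have rN: "r \<in> N"
    using r0 null_sets_completion_subset unfolding N_def by blast
  have le: "a \<le> r" if "a \<in> N" for a
    unfolding r_def using that bdd by (rule cSup_upper)
  have "inf_ess A = ennreal r"
    unfolding inf_ess_def
  proof (rule antisym)
    show "Sup {ennreal a |a. 0 \<le> a \<and> A \<inter> {0..a} \<in> null_sets lebesgue} \<le> ennreal r"
      using le by (auto intro!: Sup_least ennreal_leI simp: N_def)
    show "ennreal r \<le> Sup {ennreal a |a. 0 \<le> a \<and> A \<inter> {0..a} \<in> null_sets lebesgue}"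
      using rN by (auto intro!: Sup_upper simp: N_def)
  qed
  moreover have "A \<inter> {0..a} \<in> null_sets lebesgue \<longleftrightarrow> a \<le> r" if "0 \<le> a" for a
    using le down[OF rN] that by (auto simp: N_def)
  ultimately show ?thesis
    using that r0 by blast
qed

section \<open>Measurability of superlevel sets and hollows\<close>

lemma superlevel_subset_nonneg: "superlevel \<phi> \<nu> \<subseteq> {0..}"
  by (auto simp: superlevel_def)

lemma superlevel_antimono: "\<mu> \<le> \<nu> \<Longrightarrow> superlevel \<phi> \<nu> \<subseteq> superlevel \<phi> \<mu>"
  by (auto simp: superlevel_def)

lemma sets_superlevel:
  assumes "\<phi> \<in> borel_measurable (lebesgue_on {0..})"
  shows "superlevel \<phi> \<nu> \<in> sets lebesgue"
proof -
  have "{x \<in> space (lebesgue_on {0..}). \<nu> \<le> \<phi> x} \<in> sets (lebesgue_on {0..})"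
    using assms by measurable
  moreover have "{x \<in> space (lebesgue_on {0..}). \<nu> \<le> \<phi> x} = superlevel \<phi> \<nu>"
    by (auto simp: superlevel_def)
  ultimately show ?thesis
    by (simp add: sets_restrict_space_iff)
qed

lemma emeasure_nonzero_not_null_sets:
  assumes "emeasure M A \<noteq> 0"
  shows "A \<notin> null_sets M"
  using assms null_setsD1 by blast

text \<open>The union over all levels reduces to rational ones. If \<open>t\<close> lies in the
  hollows at level \<open>\<mu>\<close>, then \<open>\<phi> t < \<mu>\<close>, and a rational level
  strictly between them still excludes \<open>t\<close> from the superlevel set while its hull is at
  least as large.\<close>

lemma sets_hollows_below:
  assumes meas: "\<phi> \<in> borel_measurable (lebesgue_on {0..})"
  shows "hollows_below \<nu> \<phi> \<in> sets lebesgue"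
proof -
  define Q where "Q = {q :: rat. ennreal (of_rat q) < \<nu>}"
  have "hollows_below \<nu> \<phi> = (\<Union>q\<in>Q. hollows (superlevel \<phi> (ennreal (of_rat q))))"
  proof (intro antisym subsetI)
    fix t assume "t \<in> hollows_below \<nu> \<phi>"
    then obtain \<mu> where \<mu>: "\<mu> < \<nu>" and t: "t \<in> conv_ess (superlevel \<phi> \<mu>)" "t \<notin> superlevel \<phi> \<mu>"
      by (auto simp: hollows_below_def hollows_def)
    \<comment> \<open>A negative point lies outside every superlevel set whatever its value, so it
      must be excluded before \<open>\<phi> t < \<mu>\<close> can be inferred.\<close>
    have "0 \<le> t"
    proof (rule ccontr)
      assume "\<not> 0 \<le> t"
      then show False
        using t by (auto simp: conv_ess_eq[OF superlevel_subset_nonneg])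
    qed
    with t(2) have "\<phi> t < \<mu>"
      by (auto simp: superlevel_def)
    then obtain q :: rat where q: "\<phi> t < ennreal (of_rat q)" "ennreal (of_rat q) < \<mu>"
      using ennreal_rat_dense by blast
    then have "t \<in> conv_ess (superlevel \<phi> (ennreal (of_rat q)))"
      using conv_ess_mono[OF superlevel_antimono superlevel_subset_nonneg] t(1)
      by (meson less_imp_le subsetD)
    with q \<mu> show "t \<in> (\<Union>q\<in>Q. hollows (superlevel \<phi> (ennreal (of_rat q))))"
      by (force simp: Q_def hollows_def superlevel_def)
  qed (auto simp: Q_def hollows_below_def)
  moreover have "(\<Union>q\<in>Q. hollows (superlevel \<phi> (ennreal (of_rat q)))) \<in> sets lebesgue"
    unfolding hollows_def
    by (intro sets.countable_UN'' sets.Diff sets_conv_ess sets_superlevel meas) auto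
  ultimately show ?thesis by simp
qed

section \<open>Monotonicity of the tamped intervals\<close>

text \<open>Removing the hollow length from \<open>r\<close> leaves the length of
  \<open>[0, r]\<close> outside the hollows. In this form the left endpoint is visibly non-negative
  and increasing in \<open>r\<close>.\<close>

lemma tamp_y_eq:
  assumes meas: "\<phi> \<in> borel_measurable (lebesgue_on {0..})"
    and r: "0 \<le> r" "inf_ess (superlevel \<phi> (ennreal \<nu>)) = ennreal r"
  shows "tamp_y \<phi> \<nu> = measure lebesgue ({0..r} - hollows_below \<infinity> \<phi>)"
proof -
  have "measure lebesgue ({0..r} - hollows_below \<infinity> \<phi> \<inter> {0..r})
      = measure lebesgue {0..r} - measure lebesgue (hollows_below \<infinity> \<phi> \<inter> {0..r})"
    using sets_hollows_below[OF meas] r(1) by (intro measure_Diff) auto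
  moreover have "{0..r} - hollows_below \<infinity> \<phi> \<inter> {0..r} = {0..r} - hollows_below \<infinity> \<phi>"
    by auto
  ultimately show ?thesis
    using r by (simp add: tamp_y_def tamp_x_def)
qed

lemma tamp_y_nonneg:
  assumes meas: "\<phi> \<in> borel_measurable (lebesgue_on {0..})"
    and pos: "emeasure lebesgue (superlevel \<phi> (ennreal \<nu>)) \<noteq> 0"
  shows "0 \<le> tamp_y \<phi> \<nu>"
  using inf_ess_finite[OF superlevel_subset_nonneg emeasure_nonzero_not_null_sets[OF pos]]
  by (metis tamp_y_eq[OF meas] measure_nonneg)

lemma conv_ess_superlevel_Diff_hollows_below:
  assumes "\<mu> < \<nu>"
  shows "conv_ess (superlevel \<phi> \<mu>) - hollows_below \<nu> \<phi> \<subseteq> superlevel \<phi> \<mu>"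
  using assms by (auto simp: hollows_below_def hollows_def)

text \<open>Passing from \<open>\<mu>\<close> to \<open>\<nu>\<close> moves the left endpoint right
  by the measure of \<open>(r, s] - H\<close>. That set and the part of \<open>B\<close> beyond
  \<open>s\<close> are disjoint subsets of \<open>A\<close>, so the measure of the superlevel set
  drops by at least as much and the right endpoint does not increase.\<close>

lemma tamp_set_antimono:
  assumes meas: "\<phi> \<in> borel_measurable (lebesgue_on {0..})" and le: "\<mu> \<le> \<nu>"
  shows "tamp_set \<phi> \<nu> \<subseteq> tamp_set \<phi> \<mu>"
proof (cases "emeasure lebesgue (superlevel \<phi> (ennreal \<nu>)) = 0")
  case True
  then show ?thesis by (simp add: tamp_set_def)
next
  case pos\<nu>: False
  define H where "H = hollows_below \<infinity> \<phi>"
  define A where "A = superlevel \<phi> (ennreal \<mu>)"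
  define B where "B = superlevel \<phi> (ennreal \<nu>)"
  have mA: "A \<in> sets lebesgue" and mB: "B \<in> sets lebesgue" and mH: "H \<in> sets lebesgue"
    unfolding A_def B_def H_def using meas by (simp_all add: sets_superlevel sets_hollows_below)
  have A0: "A \<subseteq> {0..}" and B0: "B \<subseteq> {0..}"
    unfolding A_def B_def by (rule superlevel_subset_nonneg)+
  have BA: "B \<subseteq> A"
    unfolding A_def B_def using le by (intro superlevel_antimono ennreal_leI)
  have posB: "emeasure lebesgue B \<noteq> 0"
    using pos\<nu> by (simp add: B_def)
  have posA: "emeasure lebesgue A \<noteq> 0"
    using posB emeasure_mono[OF BA mA] by auto
  obtain r where r: "0 \<le> r" "inf_ess A = ennreal r"
    "\<And>a. 0 \<le> a \<Longrightarrow> A \<inter> {0..a} \<in> null_sets lebesgue \<longleftrightarrow> a \<le> r"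
    using inf_ess_finite[OF A0 emeasure_nonzero_not_null_sets[OF posA]] by blast
  obtain s where s: "0 \<le> s" "inf_ess B = ennreal s"
    "\<And>a. 0 \<le> a \<Longrightarrow> B \<inter> {0..a} \<in> null_sets lebesgue \<longleftrightarrow> a \<le> s"
    using inf_ess_finite[OF B0 emeasure_nonzero_not_null_sets[OF posB]] by blast
  have rs: "r \<le> s"
    using s(3)[of r] r(1) r(3)[of r] BA null_sets_completion_subset[of "B \<inter> {0..r}" "A \<inter> {0..r}"] by auto
  have y\<mu>: "tamp_y \<phi> \<mu> = measure lebesgue ({0..r} - H)"
    unfolding H_def using tamp_y_eq[OF meas r(1)] r(2) by (simp add: A_def)
  have fI: "I - H \<in> fmeasurable lebesgue" if "bounded I" "I \<in> sets borel" for I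
    using that mH by (intro fmeasurable_Diff bounded_set_imp_lmeasurable) auto
  have "tamp_y \<phi> \<nu> = measure lebesgue ({0..s} - H)"
    unfolding H_def using tamp_y_eq[OF meas s(1)] s(2) by (simp add: B_def)
  also have "{0..s} - H = ({0..r} - H) \<union> ({r<..s} - H)"
    using r(1) rs by auto
  also have "measure lebesgue \<dots> = measure lebesgue ({0..r} - H) + measure lebesgue ({r<..s} - H)"
    using fmeasurableD2[OF fI]
    by (intro measure_Union fmeasurableD[OF fI]) auto
  finally have y\<nu>: "tamp_y \<phi> \<nu> = tamp_y \<phi> \<mu> + measure lebesgue ({r<..s} - H)"
    by (simp add: y\<mu>)
  then have y_mono: "tamp_y \<phi> \<mu> \<le> tamp_y \<phi> \<nu>"
    by simp
  show ?thesis
  proof (cases "emeasure lebesgue A = \<infinity>")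
    case True
    then have "tamp_set \<phi> \<mu> = {tamp_y \<phi> \<mu>..}"
      by (simp add: tamp_set_def A_def)
    moreover have "tamp_set \<phi> \<nu> \<subseteq> {tamp_y \<phi> \<nu>..}"
      by (auto simp: tamp_set_def Let_def)
    ultimately show ?thesis
      using y_mono by auto
  next
    case finA: False
    then have fA: "A \<in> fmeasurable lebesgue"
      using mA by (simp add: fmeasurableI top.not_eq_extremum)
    then have fB: "B \<in> fmeasurable lebesgue"
      using mB BA fmeasurableI2 by blast
    have Bnull: "B \<inter> {0..s} \<in> null_sets lebesgue"
      using s by simp
    have split: "B = (B \<inter> {0..s}) \<union> (B \<inter> {s<..})"
      using B0 by auto
    have mBs: "B \<inter> {s<..} \<in> sets lebesgue"
      using mB by auto
    have notnull: "B \<inter> {s<..} \<notin> null_sets lebesgue"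
      using split Bnull emeasure_nonzero_not_null_sets[OF posB] null_sets.Un by metis
    \<comment> \<open>To the left of \<open>t\<close> the set \<open>A\<close> is not null because
      \<open>t > r\<close>; to the right it contains the non-null part of \<open>B\<close> beyond
      \<open>s\<close>.\<close>
    have "t \<in> conv_ess A" if t: "t \<in> {r<..s}" for t
    proof -
      have "A \<inter> {0..t} \<notin> null_sets lebesgue"
        using r t by auto
      moreover have "A \<inter> {t..} \<notin> null_sets lebesgue"
        using notnull null_sets_completion_subset[of "B \<inter> {s<..}" "A \<inter> {t..}"] t BA by fastforce
      ultimately show ?thesis
        using A0 by (simp add: conv_ess_eq)
    qed
    \<comment> \<open>Level \<open>\<infinity>\<close> lies above every
      \<open>ennreal \<mu>\<close>, so \<open>H\<close> already contains the hollows of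
      \<open>A\<close>.\<close>
    then have "{r<..s} - H \<subseteq> A"
      using conv_ess_superlevel_Diff_hollows_below[of "ennreal \<mu>" \<infinity> \<phi>]
      by (auto simp: A_def H_def)
    then have sub: "({r<..s} - H) \<union> (B \<inter> {s<..}) \<subseteq> A"
      using BA by auto
    have "measure lebesgue ({r<..s} - H) + measure lebesgue B
        = measure lebesgue ({r<..s} - H) + measure lebesgue (B \<inter> {s<..})"
      using measure_Un_null_set[OF mBs Bnull] split by (metis Un_commute)
    also have "\<dots> = measure lebesgue (({r<..s} - H) \<union> (B \<inter> {s<..}))"
      using mBs fmeasurableD2[OF fI] fmeasurableD2[OF fmeasurableI2[OF fB]]
      by (intro measure_Union[symmetric] fmeasurableD[OF fI]) auto
    also have "\<dots> \<le> measure lebesgue A"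
      using sub mH mBs fA by (intro measure_mono_fmeasurable sets.Un sets.Diff) auto
    finally have "tamp_y \<phi> \<nu> + measure lebesgue B \<le> tamp_y \<phi> \<mu> + measure lebesgue A"
      using y\<nu> by simp
    moreover have "tamp_set \<phi> \<mu> = {tamp_y \<phi> \<mu>..tamp_y \<phi> \<mu> + measure lebesgue A}"
      using posA finA by (simp add: tamp_set_def Let_def A_def measure_def)
    moreover have "tamp_set \<phi> \<nu> = {tamp_y \<phi> \<nu>..tamp_y \<phi> \<nu> + measure lebesgue B}"
      using posB fmeasurableD2[OF fB] by (simp add: tamp_set_def Let_def B_def measure_def)
    ultimately show ?thesis
      using y_mono by auto
  qed
qed

section \<open>Superlevel sets of the tamping\<close>

lemma convex_tamp_set: "convex (tamp_set \<phi> \<nu>)"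
  by (simp add: tamp_set_def Let_def)

lemma less_tamping_iff:
  "l < tamping \<phi> t \<longleftrightarrow> (\<exists>\<mu>>0. l < ennreal \<mu> \<and> t \<in> tamp_set \<phi> \<mu>)"
  by (auto simp: tamping_def less_Sup_iff)

text \<open>The supremum defining the tamping need not be attained, so each \<open>l < \<nu>\<close>
  is treated separately. This gives the measurability on which the final monotonicity step
  relies.\<close>

lemma is_interval_superlevel_tamping:
  assumes meas: "\<phi> \<in> borel_measurable (lebesgue_on {0..})"
  shows "is_interval (superlevel (tamping \<phi>) \<nu>)"
  unfolding is_interval_1
proof clarify
  fix a b t assume a: "a \<in> superlevel (tamping \<phi>) \<nu>" and b: "b \<in> superlevel (tamping \<phi>) \<nu>"
    and t: "a \<le> t" "t \<le> b"
  have "\<nu> \<le> tamping \<phi> t"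
  proof (rule dense_le)
    fix l assume l: "l < \<nu>"
    then have "l < tamping \<phi> a" "l < tamping \<phi> b"
      using a b by (auto simp: superlevel_def)
    then obtain \<mu> \<mu>' where \<mu>: "0 < \<mu>" "l < ennreal \<mu>" "a \<in> tamp_set \<phi> \<mu>"
      and \<mu>': "0 < \<mu>'" "l < ennreal \<mu>'" "b \<in> tamp_set \<phi> \<mu>'"
      unfolding less_tamping_iff by blast
    \<comment> \<open>By antimonotonicity the interval at the smaller level contains both endpoints,
      hence also \<open>t\<close>, and that level still exceeds \<open>l\<close>.\<close>
    then have "a \<in> tamp_set \<phi> (min \<mu> \<mu>')" "b \<in> tamp_set \<phi> (min \<mu> \<mu>')"
      using tamp_set_antimono[OF meas] by (meson min.cobounded1 min.cobounded2 subsetD)+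
    then have "t \<in> tamp_set \<phi> (min \<mu> \<mu>')"
      using convex_tamp_set t by (meson is_interval_convex_1 mem_is_interval_1_I)
    moreover have "0 < min \<mu> \<mu>'" "l < ennreal (min \<mu> \<mu>')"
      using \<mu> \<mu>' by (auto simp: min_def)
    ultimately show "l \<le> tamping \<phi> t"
      using less_tamping_iff less_imp_le by blast
  qed
  then show "t \<in> superlevel (tamping \<phi>) \<nu>"
    using a t by (auto simp: superlevel_def)
qed

text \<open>The level \<open>\<nu>\<close> itself takes part in the supremum. Non-negativity of the
  left endpoint keeps the interval in the half-line.\<close>

lemma tamp_set_subset_superlevel:
  assumes "\<phi> \<in> borel_measurable (lebesgue_on {0..})" and "0 < \<nu>"
  shows "tamp_set \<phi> \<nu> \<subseteq> superlevel (tamping \<phi>) (ennreal \<nu>)"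
proof
  fix t assume t: "t \<in> tamp_set \<phi> \<nu>"
  then have pos: "emeasure lebesgue (superlevel \<phi> (ennreal \<nu>)) \<noteq> 0"
    by (auto simp: tamp_set_def)
  have "tamp_y \<phi> \<nu> \<le> t"
    using t by (auto simp: tamp_set_def Let_def split: if_splits)
  with tamp_y_nonneg[OF assms(1) pos] have "0 \<le> t" by simp
  moreover have "ennreal \<nu> \<le> tamping \<phi> t"
    unfolding tamping_def using t assms(2) by (intro Sup_upper) auto
  ultimately show "t \<in> superlevel (tamping \<phi>) (ennreal \<nu>)"
    by (simp add: superlevel_def)
qed

section \<open>Comparison of the measures on \<open>[0, x]\<close>\<close>

theorem proposition2p13:
  fixes \<phi> :: "real \<Rightarrow> ennreal" and \<nu> x :: real
  assumes "\<phi> \<in> borel_measurable (lebesgue_on {0..})"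
    and "0 < \<nu>" and "0 \<le> x"
  shows "emeasure lebesgue ({0..x} \<inter> superlevel \<phi> (ennreal \<nu>))
       \<le> emeasure lebesgue ({0..x} \<inter> superlevel (tamping \<phi>) (ennreal \<nu>))"
proof (cases "{0..x} \<inter> superlevel \<phi> (ennreal \<nu>) \<in> null_sets lebesgue")
  case True
  then show ?thesis by (simp add: null_setsD1)
next
  case notnull: False
  define A where "A = superlevel \<phi> (ennreal \<nu>)"
  define y where "y = tamp_y \<phi> \<nu>"
  have mA: "A \<in> sets lebesgue" and A0: "A \<subseteq> {0..}"
    unfolding A_def by (rule sets_superlevel[OF assms(1)] superlevel_subset_nonneg)+
  have Anull: "A \<notin> null_sets lebesgue"
    using notnull null_sets_completion_subset[of "{0..x} \<inter> A" A] by (auto simp: A_def)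
  then have pos: "emeasure lebesgue A \<noteq> 0"
    using mA by (auto simp: null_sets_def)
  obtain r where r: "0 \<le> r" "inf_ess A = ennreal r"
    "\<And>a. 0 \<le> a \<Longrightarrow> A \<inter> {0..a} \<in> null_sets lebesgue \<longleftrightarrow> a \<le> r"
    using inf_ess_finite[OF A0 Anull] by blast
  have y0: "0 \<le> y"
    unfolding y_def using tamp_y_nonneg[OF assms(1)] pos by (simp add: A_def)
  have yr: "y \<le> r"
    unfolding y_def tamp_y_def tamp_x_def using r(1,2) by (simp add: A_def)
  \<comment> \<open>Otherwise \<open>A\<close> would be null on \<open>[0, x]\<close>, contrary to
    the present case.\<close>
  have rx: "r < x"
    using r(3)[OF assms(3)] notnull by (auto simp: A_def Int_commute)
  \<comment> \<open>Up to a null set \<open>A\<close> lies beyond \<open>r\<close>, so its part in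
    \<open>[0, x]\<close> has measure at most \<open>x - r\<close>, hence at most
    \<open>x - y\<close>.\<close>
  have "emeasure lebesgue ({0..x} \<inter> A) \<le> emeasure lebesgue ({r..x} \<union> (A \<inter> {0..r}))"
    using mA by (intro emeasure_mono sets.Un sets.Int) auto
  also have "\<dots> = emeasure lebesgue {r..x}"
    using r by (intro emeasure_Un_null_set) auto
  also have "\<dots> \<le> ennreal (x - y)"
    using rx yr by (simp add: ennreal_leI)
  finally have le_x: "emeasure lebesgue ({0..x} \<inter> A) \<le> ennreal (x - y)" .
  have le_A: "emeasure lebesgue ({0..x} \<inter> A) \<le> emeasure lebesgue A"
    using mA by (intro emeasure_mono) auto
  have "emeasure lebesgue ({0..x} \<inter> A) \<le> emeasure lebesgue ({0..x} \<inter> tamp_set \<phi> \<nu>)"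
  proof (cases "emeasure lebesgue A = \<infinity>")
    case True
    then have "{0..x} \<inter> tamp_set \<phi> \<nu> = {y..x}"
      using y0 by (auto simp: tamp_set_def A_def y_def)
    then show ?thesis
      using le_x yr rx by simp
  next
    case False
    define m where "m = enn2real (emeasure lebesgue A)"
    have m: "emeasure lebesgue A = ennreal m" "0 \<le> m"
      using False by (simp_all add: m_def top.not_eq_extremum)
    have "{0..x} \<inter> tamp_set \<phi> \<nu> = {y..min x (y + m)}"
      using y0 pos False by (auto simp: tamp_set_def A_def y_def m_def Let_def)
    then have "emeasure lebesgue ({0..x} \<inter> tamp_set \<phi> \<nu>) = ennreal (min x (y + m) - y)"
      using yr rx m(2) by simp
    \<comment> \<open>The truncated interval has length equal to the smaller of the two bounds
      \<open>le_x\<close> and \<open>le_A\<close>.\<close>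
    also have "\<dots> = min (ennreal (x - y)) (ennreal m)"
      using m(2) by (auto simp: min_def ennreal_le_iff2)
    finally show ?thesis
      using le_x le_A m by simp
  qed
  also have "\<dots> \<le> emeasure lebesgue ({0..x} \<inter> superlevel (tamping \<phi>) (ennreal \<nu>))"
    using tamp_set_subset_superlevel[OF assms(1,2)]
      real_interval_borel_measurable[OF is_interval_superlevel_tamping[OF assms(1)]]
    by (intro emeasure_mono) auto
  finally show ?thesis by (simp add: A_def)
qed

end
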